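(* Let $m\ge 2$ be a fixed integer, and for each $n\ge 1$ let $L_{n,m}$ be the length of the longest common pattern contained in $m$ independent uniformly random permutations $\pi_1,\dots,\pi_m\in S_n$. Then $L_{n,m}$ is concentrated in an interval of length $O\big(n^{\frac{m}{4m-2}}\big)$ around $\mathbb{E}(L_{n,m})$, in the following sense: for every sequence $(t_n)_{n\ge1}$ of positive reals with $t_n\to\infty$, $$\lim_{n\to\infty}\mathbb{P}\left(\left|L_{n,m}-\mathbb{E}(L_{n,m})\right|\ge t_n\, n^{\frac{m}{4m-2}}\right)=0 .$$
   Context: A permutation $\sigma=\sigma_1\cdots\sigma_k\in S_k$ (with $k\le n$) is a pattern contained in $\pi=\pi_1\cdots\pi_n\in S_n$ if there are indices $i_1<i_2<\dots<i_k$ such that $\pi_{i_1}\pi_{i_2}\cdots\pi_{i_k}$ is order isomorphic to $\sigma$, i.e. for all $a,b$, $\pi_{i_a}<\pi_{i_b}$ if and only if $\sigma_a<\sigma_b$. Given $\pi_1,\dots,\pi_m\in S_n$, a common pattern is a permutation $\sigma$ that is a pattern contained in all of the $\pi_i$; a longest common pattern is a common pattern of maximum length. *)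

theory Defs
  imports "HOL-Probability.Probability" "HOL-Combinatorics.Permutations"
begin

(* An element of S_n is a function p with "p permutes {1..n}"; p i is the i-th letter of its
   one-line notation. *)
definition perms :: "nat \<Rightarrow> (nat \<Rightarrow> nat) set" where
  "perms n = {p. p permutes {1..n}}"

definition contains_pattern ::
  "nat \<Rightarrow> (nat \<Rightarrow> nat) \<Rightarrow> nat \<Rightarrow> (nat \<Rightarrow> nat) \<Rightarrow> bool" where
  "contains_pattern n p k s \<longleftrightarrow> k \<le> n \<and> s \<in> perms k \<and>
     (\<exists>i. i ` {1..k} \<subseteq> {1..n} \<and> strict_mono_on {1..k} i \<and>
        (\<forall>a\<in>{1..k}. \<forall>b\<in>{1..k}. p (i a) < p (i b) \<longleftrightarrow> s a < s b))"

definition common_pattern ::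
  "nat \<Rightarrow> nat \<Rightarrow> (nat \<Rightarrow> nat \<Rightarrow> nat) \<Rightarrow> nat \<Rightarrow> (nat \<Rightarrow> nat) \<Rightarrow> bool" where
  "common_pattern n m P k s \<longleftrightarrow> s \<in> perms k \<and> (\<forall>j\<in>{1..m}. contains_pattern n (P j) k s)"

(* For m = 0 the set is infinite and Max is unspecified; for m \<ge> 1 it contains 0 and is
   bounded by n. *)
definition lcp_length :: "nat \<Rightarrow> nat \<Rightarrow> (nat \<Rightarrow> nat \<Rightarrow> nat) \<Rightarrow> nat" where
  "lcp_length n m P = Max {k. \<exists>s. common_pattern n m P k s}"

(* Indices outside {1..m} carry the irrelevant default value id. *)
definition random_perms :: "nat \<Rightarrow> nat \<Rightarrow> (nat \<Rightarrow> nat \<Rightarrow> nat) pmf" where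
  "random_perms n m = Pi_pmf {1..m} id (\<lambda>_. pmf_of_set (perms n))"

end

theory Submission
  imports Defs
begin

text \<open>
  Write \<open>L\<close> for the length of the longest common pattern of \<open>m\<close> uniform random permutations in
  \<open>S\<^sub>n\<close>, and \<open>\<alpha> = m / (2 m - 1)\<close>, so that the claimed scale is \<open>n powr (\<alpha> / 2)\<close>. The proof bounds the
  variance of \<open>L\<close> by a multiple of its mean, the mean by \<open>O(n powr \<alpha>)\<close>, and applies Chebyshev's
  inequality, which leaves a deviation probability of order \<open>1 / (t n)\<^sup>2\<close>.

  The variance bound rests on a Poincare inequality for the random transposition walk on the
  permutations of a finite set (lemma \<open>ssd_permutes_le\<close>): the variance of any function is at most
  a multiple of \<open>1/n\<close> times the summed mean squared changes under composition with a
  transposition. The inequality is extended to \<open>m\<close>-tuples by subadditivity of the variance over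
  independent coordinates (lemma \<open>ssd_PiE_dflt_le\<close>). For \<open>f = L\<close> the energy is small because
  \<open>L\<close> is self-certifying (lemma \<open>lcp_certificate\<close>): an occurrence of a longest common pattern uses
  only \<open>L\<close> positions of the \<open>j\<close>-th permutation, and swapping the entries at positions \<open>a\<close> and \<open>b\<close>
  lowers \<open>L\<close> by at most the number of those among \<open>a, b\<close> that are used. Of the \<open>n\<^sup>2\<close> pairs at most
  \<open>2 n L\<close> are therefore harmful, and the factor \<open>1/n\<close> leaves a variance of at most \<open>4 m E(L)\<close>
  (lemma \<open>ssd_lcp_length\<close>).

  The mean is bounded by the first moment method. A fixed pattern of length \<open>k\<close> is contained in at
  most \<open>(n choose k) n! / k!\<close> permutations (lemma \<open>card_contains_pattern\<close>); the union bound over the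
  \<open>k!\<close> patterns gives a probability of at most \<open>(n choose k) ^ m / k! ^ (m - 1)\<close> for \<open>L \<ge> k\<close>,
  which is tiny as soon as \<open>k \<ge> 6 n powr \<alpha>\<close> (lemma \<open>lcp_length_tail\<close>).

  All probabilities are uniform over finite sets, so everything is phrased with finite sums;
  dividing by the cardinality is deferred to the last step.
\<close>

hide_const (open) Finite_Cartesian_Product.transpose

section \<open>Sums of squared deviations\<close>

text \<open>
  This is \<open>card A\<close> times the variance of \<open>f\<close> under the uniform distribution on \<open>A\<close>. Without
  normalisation no weights appear when \<open>A\<close> is partitioned.
\<close>
definition ssd :: "'a set \<Rightarrow> ('a \<Rightarrow> real) \<Rightarrow> real" where
  "ssd A f = (\<Sum>x\<in>A. (f x)\<^sup>2) - (\<Sum>x\<in>A. f x)\<^sup>2 / real (card A)"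

lemma ssd_pairs:
  assumes "finite A"
  shows "ssd A f = (\<Sum>x\<in>A. \<Sum>y\<in>A. (f x - f y)\<^sup>2) / (2 * real (card A))"
proof (cases "A = {}")
  case True
  then show ?thesis by (simp add: ssd_def)
next
  case False
  with assms have c: "real (card A) > 0" by (simp add: card_gt_0_iff)
  have "(\<Sum>x\<in>A. \<Sum>y\<in>A. (f x - f y)\<^sup>2)
      = (\<Sum>x\<in>A. \<Sum>y\<in>A. (f x)\<^sup>2 + (f y)\<^sup>2 - 2 * (f x * f y))"
    by (simp add: power2_diff algebra_simps)
  also have "\<dots> = 2 * real (card A) * (\<Sum>x\<in>A. (f x)\<^sup>2) - 2 * (\<Sum>x\<in>A. f x)\<^sup>2"
    by (simp add: sum.distrib sum_subtractf power2_eq_square sum_product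
        flip: sum_distrib_left)
  finally have e: "(\<Sum>x\<in>A. \<Sum>y\<in>A. (f x - f y)\<^sup>2)
      = 2 * real (card A) * (\<Sum>x\<in>A. (f x)\<^sup>2) - 2 * (\<Sum>x\<in>A. f x)\<^sup>2" .
  show ?thesis unfolding e using c by (simp add: ssd_def diff_divide_distrib)
qed

lemma ssd_reindex:
  assumes "bij_betw h A B"
  shows "ssd B f = ssd A (\<lambda>x. f (h x))"
  using assms
  by (simp add: ssd_def bij_betw_same_card[OF assms]
      sum.reindex_bij_betw[OF assms, of f] sum.reindex_bij_betw[OF assms, of "\<lambda>x. (f x)\<^sup>2"])

text \<open>
  The law of total variance for a partition into classes of equal size: the deviation inside the
  classes plus the deviation of the class averages.
\<close>
lemma ssd_fibres:
  assumes "finite X" and "\<And>x. x \<in> X \<Longrightarrow> finite (F x)"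
    and "\<And>x. x \<in> X \<Longrightarrow> card (F x) = M" and "M > 0"
    and "\<And>x y. x \<in> X \<Longrightarrow> y \<in> X \<Longrightarrow> x \<noteq> y \<Longrightarrow> F x \<inter> F y = {}"
  shows "ssd (\<Union>x\<in>X. F x) f
       = (\<Sum>x\<in>X. ssd (F x) f) + ssd X (\<lambda>x. \<Sum>s\<in>F x. f s) / real M"
proof -
  have u: "(\<Sum>s\<in>(\<Union>x\<in>X. F x). g s) = (\<Sum>x\<in>X. \<Sum>s\<in>F x. g s)" for g :: "'b \<Rightarrow> real"
    using assms by (intro sum.UNION_disjoint) auto
  have "card (\<Union>x\<in>X. F x) = (\<Sum>x\<in>X. card (F x))"
    using assms by (intro card_UN_disjoint) auto
  also have "\<dots> = card X * M" using assms(3) by simp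
  finally have c: "card (\<Union>x\<in>X. F x) = card X * M" .
  have "(\<Sum>x\<in>X. ssd (F x) f)
      = (\<Sum>x\<in>X. \<Sum>s\<in>F x. (f s)\<^sup>2) - (\<Sum>x\<in>X. (\<Sum>s\<in>F x. f s)\<^sup>2) / real M"
    using assms(3) by (simp add: ssd_def sum_subtractf sum_divide_distrib)
  then show ?thesis using assms(4)
    by (simp add: ssd_def u c diff_divide_distrib)
qed

text \<open>
  Convexity of the variance: the deviation of an average is at most the average deviation. It
  follows from the Cauchy-Schwarz inequality applied to the pairwise differences.
\<close>
lemma ssd_sum_le:
  assumes "finite Y"
  shows "ssd Y (\<lambda>y. \<Sum>x\<in>X. f x y) \<le> real (card X) * (\<Sum>x\<in>X. ssd Y (f x))"
proof -
  have "(\<Sum>y\<in>Y. \<Sum>z\<in>Y. ((\<Sum>x\<in>X. f x y) - (\<Sum>x\<in>X. f x z))\<^sup>2)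
      \<le> (\<Sum>y\<in>Y. \<Sum>z\<in>Y. real (card X) * (\<Sum>x\<in>X. (f x y - f x z)\<^sup>2))"
    by (intro sum_mono)
       (auto simp flip: sum_subtractf intro: order_trans[OF sum_squared_le_sum_of_squares]
             simp: mult.commute)
  also have "\<dots> = real (card X) * (\<Sum>y\<in>Y. \<Sum>z\<in>Y. (\<Sum>x\<in>X. (f x y - f x z)\<^sup>2))"
    by (simp add: sum_distrib_left)
  also have "(\<Sum>y\<in>Y. \<Sum>z\<in>Y. (\<Sum>x\<in>X. (f x y - f x z)\<^sup>2))
      = (\<Sum>y\<in>Y. \<Sum>x\<in>X. \<Sum>z\<in>Y. (f x y - f x z)\<^sup>2)"
    by (intro sum.cong refl sum.swap)
  also have "\<dots> = (\<Sum>x\<in>X. \<Sum>y\<in>Y. \<Sum>z\<in>Y. (f x y - f x z)\<^sup>2)"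
    by (rule sum.swap)
  finally show ?thesis using assms
    by (simp add: ssd_pairs divide_right_mono flip: sum_divide_distrib)
qed

text \<open>
  Efron and Stein's inequality for two independent coordinates: split along the second
  coordinate, then use convexity to take the average over the first one out of the variance.
\<close>
lemma ssd_product:
  assumes "finite X" "finite Y"
  shows "ssd (X \<times> Y) f \<le> (\<Sum>y\<in>Y. ssd X (\<lambda>x. f (x, y))) + (\<Sum>x\<in>X. ssd Y (\<lambda>y. f (x, y)))"
proof (cases "X = {}")
  case True then show ?thesis by (simp add: ssd_def)
next
  case False
  with assms have c: "card X > 0" by (simp add: card_gt_0_iff)
  let ?F = "\<lambda>y. (\<lambda>x. (x, y)) ` X"
  have e: "ssd (?F y) f = ssd X (\<lambda>x. f (x, y))" for y
    by (rule ssd_reindex) (simp add: bij_betw_def inj_on_def)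
  have s: "(\<Sum>s\<in>?F y. f s) = (\<Sum>x\<in>X. f (x, y))" for y
    by (subst sum.reindex) (auto simp: inj_on_def)
  have "X \<times> Y = (\<Union>y\<in>Y. ?F y)" by auto
  then have "ssd (X \<times> Y) f = ssd (\<Union>y\<in>Y. ?F y) f" by simp
  also have "\<dots> = (\<Sum>y\<in>Y. ssd (?F y) f) + ssd Y (\<lambda>y. \<Sum>s\<in>?F y. f s) / real (card X)"
    using assms c by (intro ssd_fibres) (auto simp: card_image inj_on_def)
  also have "\<dots> = (\<Sum>y\<in>Y. ssd X (\<lambda>x. f (x, y)))
      + ssd Y (\<lambda>y. \<Sum>x\<in>X. f (x, y)) / real (card X)"
    by (simp add: e s)
  finally show ?thesis
    using ssd_sum_le[OF assms(2), where X = X and f = "\<lambda>x y. f (x, y)"] c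
    by (simp add: divide_le_eq mult.commute)
qed

text \<open>
  A Poincare inequality tensorises: if the moves \<open>e i\<close> control the variance of every function on
  \<open>X\<close>, then the same moves, applied to one coordinate at a time, control the variance on a power of
  \<open>X\<close> with the same constant. Induction on the number of coordinates, splitting one off.
\<close>
lemma ssd_PiE_dflt_le:
  fixes e :: "'i \<Rightarrow> 'x \<Rightarrow> 'x" and J :: "'j set"
  assumes "finite X" "finite J"
    and X: "\<And>g. ssd X g \<le> c * (\<Sum>i\<in>I. \<Sum>x\<in>X. (g x - g (e i x))\<^sup>2)"
  shows "ssd (PiE_dflt J d (\<lambda>_. X)) f
       \<le> c * (\<Sum>j\<in>J. \<Sum>i\<in>I. \<Sum>P\<in>PiE_dflt J d (\<lambda>_. X). (f P - f (P(j := e i (P j))))\<^sup>2)"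
  using assms(2)
proof (induction J arbitrary: f)
  case empty
  have "PiE_dflt ({} :: 'j set) d (\<lambda>_. X) = {\<lambda>_. d}" by (auto simp: PiE_dflt_def)
  then show ?case by (simp add: ssd_def)
next
  case (insert k J)
  let ?S = "PiE_dflt J d (\<lambda>_. X)" and ?h = "\<lambda>(x, P). P(k := x)"
  have fS: "finite ?S" using insert assms by blast
  have b: "bij_betw ?h (X \<times> ?S) (PiE_dflt (insert k J) d (\<lambda>_. X))"
  proof (rule bij_betwI[where g = "\<lambda>P. (P k, P(k := d))"])
    show "?h \<in> X \<times> ?S \<rightarrow> PiE_dflt (insert k J) d (\<lambda>_. X)"
      by (auto simp: PiE_dflt_def)
    show "(\<lambda>P. (P k, P(k := d))) \<in> PiE_dflt (insert k J) d (\<lambda>_. X) \<rightarrow> X \<times> ?S"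
      using insert(2) by (auto simp: PiE_dflt_def)
    show "\<And>x. x \<in> X \<times> ?S \<Longrightarrow> ((?h x) k, (?h x)(k := d)) = x"
      using insert(2) by (auto simp: PiE_dflt_def fun_eq_iff)
  qed auto
  have t: "(\<Sum>P\<in>PiE_dflt (insert k J) d (\<lambda>_. X). g P) = (\<Sum>P\<in>?S. \<Sum>x\<in>X. g (P(k := x)))"
    for g :: "_ \<Rightarrow> real"
    by (subst sum.reindex_bij_betw[OF b, symmetric])
       (subst sum.swap, simp add: sum.cartesian_product case_prod_unfold)
  have "ssd (PiE_dflt (insert k J) d (\<lambda>_. X)) f = ssd (X \<times> ?S) (\<lambda>x. f (?h x))"
    by (rule ssd_reindex[OF b])
  also have "\<dots> \<le> (\<Sum>P\<in>?S. ssd X (\<lambda>x. f (P(k := x)))) + (\<Sum>x\<in>X. ssd ?S (\<lambda>P. f (P(k := x))))"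
    using ssd_product[OF assms(1) fS, of "\<lambda>x. f (?h x)"] by simp
  also have "(\<Sum>P\<in>?S. ssd X (\<lambda>x. f (P(k := x))))
      \<le> (\<Sum>P\<in>?S. c * (\<Sum>i\<in>I. \<Sum>x\<in>X. (f (P(k := x)) - f (P(k := e i x)))\<^sup>2))"
    by (intro sum_mono X)
  also have "\<dots> = c * (\<Sum>i\<in>I. \<Sum>P\<in>PiE_dflt (insert k J) d (\<lambda>_. X). (f P - f (P(k := e i (P k))))\<^sup>2)"
    unfolding t sum_distrib_left[symmetric] by (subst sum.swap) simp
  also have "(\<Sum>x\<in>X. ssd ?S (\<lambda>P. f (P(k := x))))
      \<le> (\<Sum>x\<in>X. c * (\<Sum>j\<in>J. \<Sum>i\<in>I. \<Sum>P\<in>?S. (f (P(k := x)) - f ((P(j := e i (P j)))(k := x)))\<^sup>2))"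
    by (intro sum_mono insert.IH)
  also have "\<dots> = c * (\<Sum>x\<in>X. \<Sum>j\<in>J. \<Sum>i\<in>I. \<Sum>P\<in>?S. (f (P(k := x)) - f ((P(j := e i (P j)))(k := x)))\<^sup>2)"
    by (simp add: sum_distrib_left)
  also have "(\<Sum>x\<in>X. \<Sum>j\<in>J. \<Sum>i\<in>I. \<Sum>P\<in>?S. (f (P(k := x)) - f ((P(j := e i (P j)))(k := x)))\<^sup>2)
      = (\<Sum>j\<in>J. \<Sum>x\<in>X. \<Sum>i\<in>I. \<Sum>P\<in>?S. (f (P(k := x)) - f ((P(j := e i (P j)))(k := x)))\<^sup>2)"
    by (rule sum.swap)
  also have "\<dots> = (\<Sum>j\<in>J. \<Sum>i\<in>I. \<Sum>P\<in>PiE_dflt (insert k J) d (\<lambda>_. X). (f P - f (P(j := e i (P j))))\<^sup>2)"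
  proof (rule sum.cong[OF refl])
    fix j assume "j \<in> J"
    with insert(2) have "j \<noteq> k" by auto
    then show "(\<Sum>x\<in>X. \<Sum>i\<in>I. \<Sum>P\<in>?S. (f (P(k := x)) - f ((P(j := e i (P j)))(k := x)))\<^sup>2)
      = (\<Sum>i\<in>I. \<Sum>P\<in>PiE_dflt (insert k J) d (\<lambda>_. X). (f P - f (P(j := e i (P j))))\<^sup>2)"
      unfolding t by (subst sum.swap, intro sum.cong refl, subst sum.swap) (simp add: fun_upd_twist)
  qed
  finally show ?case
    by (simp only: sum.insert[OF insert(1,2)] distrib_left)
qed

section \<open>A Poincare inequality for random transpositions\<close>

lemma permutes_comp_transpose:
  assumes "p permutes A"
  shows "p \<circ> transpose v w = transpose (p v) (p w) \<circ> p"
  using injD[OF permutes_inj[OF assms]] by (auto simp: fun_eq_iff Transposition.transpose_def)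

text \<open>
  Permutations with a prescribed value at \<open>v\<close> correspond to permutations of the remaining points,
  compatibly with composing by transpositions from the right. This is what makes an induction on
  the size of the set possible.
\<close>
lemma bij_betw_permutes_fibre:
  assumes "v \<in> A" "x \<in> A"
  shows "bij_betw (\<lambda>t. transpose v x \<circ> t) {t. t permutes A - {v}} {p. p permutes A \<and> p v = x}"
proof (rule bij_betwI[where g = "\<lambda>p. transpose v x \<circ> p"])
  show "(\<lambda>t. transpose v x \<circ> t) \<in> {t. t permutes A - {v}} \<rightarrow> {p. p permutes A \<and> p v = x}"
  proof safe
    fix t assume t: "t permutes A - {v}"
    then have "t permutes A" by (rule permutes_subset) auto
    then show "transpose v x \<circ> t permutes A"
      using assms by (intro permutes_compose permutes_swap_id)
    show "(transpose v x \<circ> t) v = x"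
      using permutes_not_in[OF t, of v] by simp
  qed
  show "(\<lambda>p. transpose v x \<circ> p) \<in> {p. p permutes A \<and> p v = x} \<rightarrow> {t. t permutes A - {v}}"
    using assms(1) permutes_insert_lemma[of _ v "A - {v}"] by (auto simp: insert_absorb)
qed (auto simp: fun_eq_iff)

lemma bij_betw_permutes_translate:
  assumes "x \<in> A" "y \<in> A"
  shows "bij_betw (\<lambda>p. transpose x y \<circ> p)
    {p. p permutes A \<and> p v = x} {p. p permutes A \<and> p v = y}"
  by (rule bij_betwI[where g = "\<lambda>p. transpose x y \<circ> p"])
     (use assms in \<open>auto simp: fun_eq_iff intro!: permutes_compose permutes_swap_id\<close>)

text \<open>
  The induction step for the Poincare inequality, conditioning on the value at one point \<open>v\<close>. Inside
  a class the induction hypothesis applies. The averages over the classes \<open>p v = x\<close> and \<open>p v = y\<close> are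
  compared by coupling \<open>p\<close> with \<open>transpose x y \<circ> p\<close>, which is \<open>p\<close> composed with the transposition of \<open>v\<close>
  and some \<open>w\<close>; as \<open>y\<close> runs through \<open>A\<close>, so does \<open>w\<close>.
\<close>
lemma ssd_permutes_condition:
  fixes f :: "('a \<Rightarrow> 'a) \<Rightarrow> real"
  defines "d \<equiv> \<lambda>A a b. \<Sum>p | p permutes A. (f p - f (p \<circ> transpose a b))\<^sup>2"
  assumes A: "finite A" "v \<in> A"
    and IH: "\<And>g. ssd {p. p permutes A - {v}} g
      \<le> c * (\<Sum>(a, b)\<in>(A - {v}) \<times> (A - {v}). \<Sum>p | p permutes A - {v}. (g p - g (p \<circ> transpose a b))\<^sup>2)"
  shows "ssd {p. p permutes A} f
      \<le> c * (\<Sum>(a, b)\<in>(A - {v}) \<times> (A - {v}). d A a b) + (\<Sum>w\<in>A. d A v w) / (2 * real (card A))"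
proof -
  define F where "F x = {p. p permutes A \<and> p v = x}" for x
  define M where "M = card {p. p permutes A - {v}}"
  have M: "M > 0" using A by (simp add: M_def card_permutations)
  have fS: "finite {p. p permutes A}" using A by (simp add: finite_permutations)
  have fF: "finite (F x)" for x by (rule finite_subset[OF _ fS]) (auto simp: F_def)
  have cF: "card (F x) = M" if "x \<in> A" for x
    using bij_betw_same_card[OF bij_betw_permutes_fibre[OF A(2) that]] by (simp add: F_def M_def)
  have UF: "{p. p permutes A} = (\<Union>x\<in>A. F x)"
    using A(2) by (auto simp: F_def permutes_in_image)
  have sF: "(\<Sum>p | p permutes A. g p) = (\<Sum>x\<in>A. \<Sum>p\<in>F x. g p)" for g :: "_ \<Rightarrow> real"
    unfolding UF using A(1) fF by (intro sum.UNION_disjoint) (auto simp: F_def)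
  have "ssd (\<Union>x\<in>A. F x) f = (\<Sum>x\<in>A. ssd (F x) f) + ssd A (\<lambda>x. \<Sum>s\<in>F x. f s) / real M"
    using A(1) fF cF M by (intro ssd_fibres) (auto simp: F_def)
  then have eq: "ssd {p. p permutes A} f
      = (\<Sum>x\<in>A. ssd (F x) f) + ssd A (\<lambda>x. \<Sum>s\<in>F x. f s) / real M"
    by (simp add: UF)

  have "ssd (F x) f \<le> c * (\<Sum>(a, b)\<in>(A - {v}) \<times> (A - {v}). \<Sum>p\<in>F x. (f p - f (p \<circ> transpose a b))\<^sup>2)"
    if x: "x \<in> A" for x
  proof -
    note b = bij_betw_permutes_fibre[OF A(2) x, folded F_def]
    have "ssd (F x) f = ssd {p. p permutes A - {v}} (\<lambda>t. f (transpose v x \<circ> t))"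
      by (rule ssd_reindex[OF b])
    also have "\<dots> \<le> c * (\<Sum>(a, b)\<in>(A - {v}) \<times> (A - {v}). \<Sum>t | t permutes A - {v}.
        (f (transpose v x \<circ> t) - f (transpose v x \<circ> (t \<circ> transpose a b)))\<^sup>2)"
      by (rule IH)
    finally have le: "ssd (F x) f \<le> c * (\<Sum>(a, b)\<in>(A - {v}) \<times> (A - {v}). \<Sum>t | t permutes A - {v}.
        (f (transpose v x \<circ> t) - f (transpose v x \<circ> (t \<circ> transpose a b)))\<^sup>2)" .
    have "(\<Sum>t | t permutes A - {v}.
        (f (transpose v x \<circ> t) - f (transpose v x \<circ> (t \<circ> transpose a b)))\<^sup>2)
      = (\<Sum>p\<in>F x. (f p - f (p \<circ> transpose a b))\<^sup>2)" for a b
      by (subst sum.reindex_bij_betw[OF b, symmetric]) (simp add: comp_assoc)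
    with le show ?thesis by (simp only:)
  qed
  then have "(\<Sum>x\<in>A. ssd (F x) f)
      \<le> (\<Sum>x\<in>A. c * (\<Sum>(a, b)\<in>(A - {v}) \<times> (A - {v}). \<Sum>p\<in>F x. (f p - f (p \<circ> transpose a b))\<^sup>2))"
    by (rule sum_mono)
  also have "\<dots> = c * (\<Sum>(a, b)\<in>(A - {v}) \<times> (A - {v}). d A a b)"
    unfolding d_def sF
    by (subst sum_distrib_left[symmetric], subst sum.swap) (simp add: case_prod_unfold)
  finally have within: "(\<Sum>x\<in>A. ssd (F x) f) \<le> c * (\<Sum>(a, b)\<in>(A - {v}) \<times> (A - {v}). d A a b)" .

  have "((\<Sum>s\<in>F x. f s) - (\<Sum>s\<in>F y. f s))\<^sup>2
      \<le> real M * (\<Sum>p\<in>F x. (f p - f (transpose (p v) y \<circ> p))\<^sup>2)" if xy: "x \<in> A" "y \<in> A" for x y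
  proof -
    have "(\<Sum>s\<in>F y. f s) = (\<Sum>p\<in>F x. f (transpose x y \<circ> p))"
      by (rule sum.reindex_bij_betw[OF bij_betw_permutes_translate[OF xy, of v, folded F_def], symmetric])
    then have "((\<Sum>s\<in>F x. f s) - (\<Sum>s\<in>F y. f s))\<^sup>2 = (\<Sum>p\<in>F x. f p - f (transpose x y \<circ> p))\<^sup>2"
      by (simp add: sum_subtractf)
    also have "\<dots> \<le> (\<Sum>p\<in>F x. (f p - f (transpose x y \<circ> p))\<^sup>2) * real (card (F x))"
      by (rule sum_squared_le_sum_of_squares)
    also have "(\<Sum>p\<in>F x. (f p - f (transpose x y \<circ> p))\<^sup>2)
        = (\<Sum>p\<in>F x. (f p - f (transpose (p v) y \<circ> p))\<^sup>2)"
      by (rule sum.cong) (auto simp: F_def)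
    finally show ?thesis using cF[OF xy(1)] by (simp add: mult.commute)
  qed
  then have "(\<Sum>x\<in>A. \<Sum>y\<in>A. ((\<Sum>s\<in>F x. f s) - (\<Sum>s\<in>F y. f s))\<^sup>2)
      \<le> (\<Sum>x\<in>A. \<Sum>y\<in>A. real M * (\<Sum>p\<in>F x. (f p - f (transpose (p v) y \<circ> p))\<^sup>2))"
    by (intro sum_mono)
  also have "\<dots> = real M * (\<Sum>x\<in>A. \<Sum>y\<in>A. \<Sum>p\<in>F x. (f p - f (transpose (p v) y \<circ> p))\<^sup>2)"
    by (simp add: sum_distrib_left)
  also have "(\<Sum>x\<in>A. \<Sum>y\<in>A. \<Sum>p\<in>F x. (f p - f (transpose (p v) y \<circ> p))\<^sup>2)
      = (\<Sum>p | p permutes A. \<Sum>y\<in>A. (f p - f (transpose (p v) y \<circ> p))\<^sup>2)"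
    unfolding sF by (intro sum.cong refl sum.swap)
  also have "\<dots> = (\<Sum>p | p permutes A. \<Sum>w\<in>A. (f p - f (p \<circ> transpose v w))\<^sup>2)"
  proof (rule sum.cong[OF refl])
    fix p assume "p \<in> {p. p permutes A}"
    then have p: "p permutes A" by simp
    show "(\<Sum>y\<in>A. (f p - f (transpose (p v) y \<circ> p))\<^sup>2) = (\<Sum>w\<in>A. (f p - f (p \<circ> transpose v w))\<^sup>2)"
      unfolding permutes_comp_transpose[OF p]
      by (rule sum.reindex_bij_betw[OF permutes_imp_bij[OF p], symmetric])
  qed
  also have "\<dots> = (\<Sum>w\<in>A. d A v w)"
    unfolding d_def by (rule sum.swap)
  finally have "ssd A (\<lambda>x. \<Sum>s\<in>F x. f s) \<le> real M * (\<Sum>w\<in>A. d A v w) / (2 * real (card A))"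
    unfolding ssd_pairs[OF A(1)] by (rule divide_right_mono) simp
  then have "ssd A (\<lambda>x. \<Sum>s\<in>F x. f s) / real M \<le> (\<Sum>w\<in>A. d A v w) / (2 * real (card A))"
    using M by (simp add: divide_le_eq mult.commute)
  with within eq show ?thesis by linarith
qed

text \<open>
  Poincare inequality for random transpositions. The previous lemma for a single \<open>v\<close> treats the
  transpositions moving \<open>v\<close> differently from the others, and iterating it in a fixed order of the
  points would give unequal weights and lose a logarithm in the application. Averaging over all
  \<open>v\<close> in every step restores the symmetry: each transposition avoids \<open>n - 2\<close> of the points, and the
  constant \<open>1 / (2 n)\<close> reproduces itself.
\<close>
lemma ssd_permutes_le:
  fixes f :: "('a \<Rightarrow> 'a) \<Rightarrow> real"
  assumes "finite A"
  shows "ssd {p. p permutes A} f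
    \<le> 1 / (2 * real (card A)) * (\<Sum>(a, b)\<in>A \<times> A. \<Sum>p | p permutes A. (f p - f (p \<circ> transpose a b))\<^sup>2)"
  using assms
proof (induction A arbitrary: f rule: finite_remove_induct)
  case empty
  have "{p :: 'a \<Rightarrow> 'a. p permutes {}} = {id}" by auto
  then show ?case by (simp add: ssd_def)
next
  case (remove A)
  define d where "d a b = (\<Sum>p | p permutes A. (f p - f (p \<circ> transpose a b))\<^sup>2)" for a b
  define D where "D = (\<Sum>(a, b)\<in>A \<times> A. d a b)"
  define n where "n = card A"
  define c where "c = 1 / (2 * (real n - 1))"
  have n: "n \<ge> 1" using remove(1,2) by (simp add: n_def Suc_le_eq card_gt_0_iff)
  have d0: "d a a = 0" for a by (simp add: d_def)
  have D: "D \<ge> 0" unfolding D_def d_def by (intro sum_nonneg) (auto intro: sum_nonneg)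
  have step: "ssd {p. p permutes A} f
      \<le> c * (\<Sum>(a, b)\<in>(A - {v}) \<times> (A - {v}). d a b) + (\<Sum>w\<in>A. d v w) / (2 * real n)" if v: "v \<in> A" for v
    unfolding d_def n_def
  proof (rule ssd_permutes_condition[OF remove(1) v])
    have e: "1 / (2 * real (card (A - {v}))) = c"
      using v remove(1) n by (simp add: n_def c_def of_nat_diff)
    show "ssd {p. p permutes A - {v}} g \<le> c * (\<Sum>(a, b)\<in>(A - {v}) \<times> (A - {v}).
        \<Sum>p | p permutes A - {v}. (g p - g (p \<circ> transpose a b))\<^sup>2)" for g
      using remove.IH[OF v, of g] unfolding e .
  qed
  \<comment> \<open>A pair of distinct points avoids exactly \<open>n - 2\<close> choices of \<open>v\<close>; pairs \<open>(a, a)\<close> contribute zero.\<close>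
  have "(\<Sum>v\<in>A. \<Sum>(a, b)\<in>(A - {v}) \<times> (A - {v}). d a b)
      = (\<Sum>v\<in>A. \<Sum>x\<in>A \<times> A. if fst x \<noteq> v \<and> snd x \<noteq> v then d (fst x) (snd x) else 0)"
    using remove(1) by (intro sum.cong refl sum.mono_neutral_cong_left) (auto split: if_splits)
  also have "\<dots> = (\<Sum>x\<in>A \<times> A. \<Sum>v\<in>A. if fst x \<noteq> v \<and> snd x \<noteq> v then d (fst x) (snd x) else 0)"
    by (rule sum.swap)
  also have "\<dots> = (\<Sum>x\<in>A \<times> A. (real n - 2) * d (fst x) (snd x))"
  proof (rule sum.cong[OF refl])
    fix x assume x: "x \<in> A \<times> A"
    have "(\<Sum>v\<in>A. if fst x \<noteq> v \<and> snd x \<noteq> v then d (fst x) (snd x) else 0)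
        = (\<Sum>v\<in>A - {fst x, snd x}. d (fst x) (snd x))"
      using remove(1) by (intro sum.mono_neutral_cong_right) (auto split: if_splits)
    also have "\<dots> = real (card (A - {fst x, snd x})) * d (fst x) (snd x)"
      by simp
    also have "\<dots> = (real n - 2) * d (fst x) (snd x)"
    proof (cases "fst x = snd x")
      case False
      with x remove(1) have c2: "card {fst x, snd x} = 2" and sub: "{fst x, snd x} \<subseteq> A" by auto
      have "2 \<le> card A" using card_mono[OF remove(1) sub] c2 by simp
      then have "real (card (A - {fst x, snd x})) = real n - 2"
        using c2 sub remove(1) by (simp add: card_Diff_subset n_def of_nat_diff)
      then show ?thesis by simp
    qed (simp add: d0)
    finally show "(\<Sum>v\<in>A. if fst x \<noteq> v \<and> snd x \<noteq> v then d (fst x) (snd x) else 0)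
        = (real n - 2) * d (fst x) (snd x)" .
  qed
  also have "\<dots> = (real n - 2) * D"
    by (simp add: D_def sum_distrib_left case_prod_unfold)
  finally have s1: "(\<Sum>v\<in>A. \<Sum>(a, b)\<in>(A - {v}) \<times> (A - {v}). d a b) = (real n - 2) * D" .
  have "real n * ssd {p. p permutes A} f = (\<Sum>v\<in>A. ssd {p. p permutes A} f)" by (simp add: n_def)
  also have "\<dots> \<le> (\<Sum>v\<in>A. c * (\<Sum>(a, b)\<in>(A - {v}) \<times> (A - {v}). d a b) + (\<Sum>w\<in>A. d v w) / (2 * real n))"
    by (intro sum_mono step)
  also have "\<dots> = c * ((real n - 2) * D) + D / (2 * real n)"
    by (simp add: sum.distrib s1 D_def sum.cartesian_product flip: sum_distrib_left sum_divide_distrib)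
  also have "\<dots> = (c * (real n - 2) + 1 / (2 * real n)) * D"
    by (simp add: algebra_simps)
  also have "\<dots> \<le> 1 / 2 * D"
  proof (rule mult_right_mono[OF _ D])
    show "c * (real n - 2) + 1 / (2 * real n) \<le> 1 / 2"
    proof (cases "n = 1")
      case False
      with n have "real n \<ge> 2" by linarith
      then show ?thesis by (simp add: c_def field_simps)
    qed (simp add: c_def)
  qed
  finally have "ssd {p. p permutes A} f \<le> 1 / (2 * real n) * D"
    using n by (simp add: field_simps)
  then show ?case unfolding D_def d_def n_def .
qed

section \<open>Standardization and common patterns\<close>

definition rank_in :: "nat set \<Rightarrow> nat \<Rightarrow> nat" where
  "rank_in K x = card {y \<in> K. y \<le> x}"

lemma rank_in_strict_mono:
  assumes "finite K"
  shows "strict_mono_on K (rank_in K)"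
  unfolding strict_mono_on_def rank_in_def
  using assms by (auto intro!: psubset_card_mono) (metis (no_types, lifting) mem_Collect_eq order.refl linorder_not_less)

lemma bij_betw_rank_in:
  assumes "finite K"
  shows "bij_betw (rank_in K) K {1..card K}"
proof -
  have inj: "inj_on (rank_in K) K"
    by (rule strict_mono_on_imp_inj_on[OF rank_in_strict_mono[OF assms]])
  have "rank_in K x \<in> {1..card K}" if "x \<in> K" for x
  proof -
    have "{x} \<subseteq> {y \<in> K. y \<le> x}" using that by auto
    from card_mono[OF _ this] have "1 \<le> rank_in K x" using assms by (simp add: rank_in_def)
    moreover have "rank_in K x \<le> card K" using assms by (auto simp: rank_in_def intro: card_mono)
    ultimately show ?thesis by simp
  qed
  then have "rank_in K ` K \<subseteq> {1..card K}" by auto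
  moreover have "card (rank_in K ` K) = card {1..card K}" using inj by (simp add: card_image)
  ultimately have "rank_in K ` K = {1..card K}" by (intro card_subset_eq) auto
  with inj show ?thesis by (simp add: bij_betw_def)
qed

text \<open>
  Two injective maps that order a finite set in the same way and have the same image are equal,
  since each value is determined by its rank in the image. It will identify both the positions and
  the values of two occurrences of one pattern.
\<close>
lemma order_iso_eq:
  fixes f g :: "'a \<Rightarrow> nat"
  assumes "finite A" and im: "f ` A = g ` A"
    and inj: "inj_on f A" "inj_on g A"
    and ord: "\<And>a b. a \<in> A \<Longrightarrow> b \<in> A \<Longrightarrow> f a < f b \<longleftrightarrow> g a < g b"
    and a: "a \<in> A"
  shows "f a = g a"
proof -
  have r: "rank_in (h ` A) (h a) = card {b \<in> A. h b \<le> h a}" if "inj_on h A" for h :: "'a \<Rightarrow> nat"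
  proof -
    have "{y \<in> h ` A. y \<le> h a} = h ` {b \<in> A. h b \<le> h a}" by auto
    then show ?thesis using that
      by (simp add: rank_in_def card_image inj_on_subset[OF that])
  qed
  have "{b \<in> A. f b \<le> f a} = {b \<in> A. g b \<le> g a}"
    using ord a by (auto simp: linorder_not_less[symmetric])
  then have "rank_in (f ` A) (f a) = rank_in (f ` A) (g a)"
    using r[OF inj(1)] r[OF inj(2)] im by simp
  then show ?thesis
    using strict_mono_on_imp_inj_on[OF rank_in_strict_mono[of "f ` A"]] assms(1) a im
    by (auto dest!: inj_onD)
qed

lemma standardization:
  fixes K :: "nat set" and h :: "nat \<Rightarrow> nat"
  assumes K: "finite K" and h: "inj_on h K"
  obtains e s where "e ` {1..card K} = K" "strict_mono_on {1..card K} e" "s \<in> perms (card K)"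
    "\<And>a b. a \<in> {1..card K} \<Longrightarrow> b \<in> {1..card K} \<Longrightarrow> s a < s b \<longleftrightarrow> h (e a) < h (e b)"
proof -
  define e where "e = inv_into K (rank_in K)"
  have e: "bij_betw e {1..card K} K"
    unfolding e_def by (rule bij_betw_inv_into[OF bij_betw_rank_in[OF K]])
  have eK: "e a \<in> K" if "a \<in> {1..card K}" for a
    using e that by (auto simp: bij_betw_def)
  have re: "rank_in K (e a) = a" if "a \<in> {1..card K}" for a
    using that bij_betw_inv_into_right[OF bij_betw_rank_in[OF K]] by (simp add: e_def)
  have "strict_mono_on {1..card K} e"
  proof (rule strict_mono_onI)
    fix a b assume ab: "a \<in> {1..card K}" "b \<in> {1..card K}" "a < b"
    then have "rank_in K (e a) < rank_in K (e b)" by (simp add: re)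
    then show "e a < e b"
      using strict_mono_on_less[OF rank_in_strict_mono[OF K]] ab eK by blast
  qed
  moreover
  define s where "s a = (if a \<in> {1..card K} then rank_in (h ` K) (h (e a)) else a)" for a
  have "bij_betw (rank_in (h ` K) \<circ> (h \<circ> e)) {1..card K} {1..card (h ` K)}"
    using e bij_betw_rank_in[of "h ` K"] K h
    by (intro bij_betw_trans[of _ _ "h ` K"] bij_betw_trans[of e _ K]) (auto simp: bij_betw_def)
  then have "bij_betw s {1..card K} {1..card K}"
    using h by (subst bij_betw_cong[of _ _ "rank_in (h ` K) \<circ> (h \<circ> e)"]) (auto simp: s_def card_image)
  then have "s \<in> perms (card K)"
    by (auto simp: perms_def s_def intro!: bij_imp_permutes)
  moreover have "s a < s b \<longleftrightarrow> h (e a) < h (e b)"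
    if "a \<in> {1..card K}" "b \<in> {1..card K}" for a b
    using that eK K strict_mono_on_less[OF rank_in_strict_mono[of "h ` K"], of "h (e a)" "h (e b)"]
    by (simp add: s_def)
  moreover have "e ` {1..card K} = K" using e by (simp add: bij_betw_def)
  ultimately show thesis using that by blast
qed

text \<open>
  Occurrence of a pattern whose letters are indexed by an arbitrary finite set \<open>K\<close> and whose order is
  given by an arbitrary key \<open>h\<close>. Passing to a subpattern is then restriction to a subset of \<open>K\<close>,
  without renumbering; standardization is done once, in \<open>common_pattern_embeds\<close>.
\<close>
definition embeds :: "nat \<Rightarrow> (nat \<Rightarrow> nat) \<Rightarrow> nat set \<Rightarrow> (nat \<Rightarrow> nat) \<Rightarrow> (nat \<Rightarrow> nat) \<Rightarrow> bool" where
  "embeds n p K h i \<longleftrightarrow> i ` K \<subseteq> {1..n} \<and> strict_mono_on K i \<and>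
     (\<forall>a\<in>K. \<forall>b\<in>K. p (i a) < p (i b) \<longleftrightarrow> h a < h b)"

lemma embeds_subset:
  assumes "embeds n p K h i" "K' \<subseteq> K"
  shows "embeds n p K' h i"
  using assms unfolding embeds_def strict_mono_on_def by blast

lemma contains_pattern_embeds:
  "contains_pattern n p k s \<longleftrightarrow> k \<le> n \<and> s \<in> perms k \<and> (\<exists>i. embeds n p {1..k} s i)"
  by (simp add: contains_pattern_def embeds_def)

lemma common_pattern_embeds:
  assumes "finite K" "inj_on h K" "m \<ge> 1"
    and emb: "\<And>j. j \<in> {1..m} \<Longrightarrow> embeds n (P j) K h (i j)"
  shows "\<exists>s. common_pattern n m P (card K) s"
proof -
  obtain e s where e: "e ` {1..card K} = K" "strict_mono_on {1..card K} e"
    and s: "s \<in> perms (card K)"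
      "\<And>a b. a \<in> {1..card K} \<Longrightarrow> b \<in> {1..card K} \<Longrightarrow> s a < s b \<longleftrightarrow> h (e a) < h (e b)"
    using standardization[OF assms(1,2)] by metis
  have "embeds n (P 1) K h (i 1)" using assms(3) by (intro emb) auto
  then have "i 1 ` K \<subseteq> {1..n}" "inj_on (i 1) K"
    by (auto simp: embeds_def intro: strict_mono_on_imp_inj_on)
  from card_inj_on_le[OF this(2,1)] have k: "card K \<le> n" by simp
  have "embeds n (P j) {1..card K} s (i j \<circ> e)" if "j \<in> {1..m}" for j
  proof -
    note E = emb[OF that, unfolded embeds_def]
    have eK: "e a \<in> K" if "a \<in> {1..card K}" for a using e(1) that by blast
    show ?thesis unfolding embeds_def
    proof (intro conjI ballI)
      show "(i j \<circ> e) ` {1..card K} \<subseteq> {1..n}" using E e(1) by (metis image_comp)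
      show "strict_mono_on {1..card K} (i j \<circ> e)"
        using E e(2) eK by (auto simp: strict_mono_on_def)
      show "P j ((i j \<circ> e) a) < P j ((i j \<circ> e) b) \<longleftrightarrow> s a < s b"
        if "a \<in> {1..card K}" "b \<in> {1..card K}" for a b
        using that E eK s(2) by simp
    qed
  qed
  then show ?thesis
    unfolding common_pattern_def contains_pattern_embeds using k s(1) by blast
qed

lemma common_pattern_le:
  assumes "m \<ge> 1" "common_pattern n m P k s"
  shows "k \<le> n"
  using assms by (auto simp: common_pattern_def contains_pattern_def)

lemma common_pattern_0: "common_pattern n m P 0 id"
  by (auto simp: common_pattern_def contains_pattern_def perms_def)

lemma lcp_length_props:
  assumes "m \<ge> 1"
  shows lcp_length_ge: "common_pattern n m P k s \<Longrightarrow> k \<le> lcp_length n m P"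
    and lcp_length_attained: "\<exists>s. common_pattern n m P (lcp_length n m P) s"
    and lcp_length_le: "lcp_length n m P \<le> n"
proof -
  let ?S = "{k. \<exists>s. common_pattern n m P k s}"
  have "?S \<subseteq> {..n}" using common_pattern_le[OF assms] by auto
  then have fin: "finite ?S" by (rule finite_subset) simp
  have ne: "?S \<noteq> {}" using common_pattern_0 by blast
  show "common_pattern n m P k s \<Longrightarrow> k \<le> lcp_length n m P"
    unfolding lcp_length_def by (rule Max_ge[OF fin]) auto
  show att: "\<exists>s. common_pattern n m P (lcp_length n m P) s"
    using Max_in[OF fin ne] by (simp add: lcp_length_def)
  then show "lcp_length n m P \<le> n" using common_pattern_le[OF assms] by blast
qed

lemma lcp_occurrence:
  assumes "m \<ge> 1"
  obtains s i where "inj_on s {1..lcp_length n m P}"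
    "\<And>j. j \<in> {1..m} \<Longrightarrow> embeds n (P j) {1..lcp_length n m P} s (i j)"
proof -
  obtain s where "common_pattern n m P (lcp_length n m P) s"
    using lcp_length_attained[OF assms] by blast
  then have "s \<in> perms (lcp_length n m P)"
    and "\<forall>j\<in>{1..m}. \<exists>i. embeds n (P j) {1..lcp_length n m P} s i"
    by (auto simp: common_pattern_def contains_pattern_embeds)
  moreover from this(1) have "inj_on s {1..lcp_length n m P}"
    by (auto simp: perms_def intro: permutes_inj_on)
  ultimately show thesis using that by (metis (no_types, lifting))
qed

lemma common_pattern_if_le_lcp:
  assumes "m \<ge> 1" "k \<le> lcp_length n m P"
  shows "\<exists>s. common_pattern n m P k s"
proof -
  obtain s i where s: "inj_on s {1..lcp_length n m P}"
    "\<And>j. j \<in> {1..m} \<Longrightarrow> embeds n (P j) {1..lcp_length n m P} s (i j)"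
    using lcp_occurrence[OF assms(1)] by metis
  have sub: "{1..k} \<subseteq> {1..lcp_length n m P}" using assms(2) by auto
  have "\<exists>s. common_pattern n m P (card {1..k}) s"
    by (rule common_pattern_embeds[OF _ inj_on_subset[OF s(1) sub] assms(1)
          embeds_subset[OF s(2) sub]]) simp_all
  then show ?thesis by simp
qed

text \<open>
  The set \<open>C j\<close> consists of the positions in the \<open>j\<close>-th permutation of one fixed occurrence of a longest
  common pattern. After the entries at \<open>a\<close> and \<open>b\<close> are swapped, deleting the letters placed at
  \<open>a\<close> or \<open>b\<close> leaves a pattern that is still common.
\<close>
lemma lcp_certificate:
  assumes "m \<ge> 1"
  obtains C where
    "\<And>j. j \<in> {1..m} \<Longrightarrow> C j \<subseteq> {1..n} \<and> card (C j) = lcp_length n m P"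
    "\<And>j a b. j \<in> {1..m} \<Longrightarrow>
      lcp_length n m P \<le> lcp_length n m (P(j := P j \<circ> transpose a b)) + of_bool (a \<in> C j) + of_bool (b \<in> C j)"
proof -
  define k where "k = lcp_length n m P"
  obtain s i where s: "inj_on s {1..k}"
    and emb: "\<And>j. j \<in> {1..m} \<Longrightarrow> embeds n (P j) {1..k} s (i j)"
    using lcp_occurrence[OF assms] unfolding k_def by metis
  define C where "C j = i j ` {1..k}" for j
  have inj: "inj_on (i j) {1..k}" if "j \<in> {1..m}" for j
    using emb[OF that] by (auto simp: embeds_def intro: strict_mono_on_imp_inj_on)
  have "k \<le> lcp_length n m (P(j := P j \<circ> transpose a b)) + of_bool (a \<in> C j) + of_bool (b \<in> C j)"
    if j: "j \<in> {1..m}" for j a b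
  proof -
    define K where "K = {r \<in> {1..k}. i j r \<noteq> a \<and> i j r \<noteq> b}"
    have one: "card {r \<in> {1..k}. i j r = c} \<le> of_bool (c \<in> C j)" for c
    proof (cases "c \<in> C j")
      case True
      have "card {r \<in> {1..k}. i j r = c} \<le> card {c}"
        by (rule card_inj_on_le[of "i j"]) (auto intro: inj_on_subset[OF inj[OF j]])
      with True show ?thesis by simp
    next
      case False
      then have "{r \<in> {1..k}. i j r = c} = {}" by (auto simp: C_def)
      then show ?thesis by (simp only: card.empty)
    qed
    have "{1..k} = K \<union> ({r \<in> {1..k}. i j r = a} \<union> {r \<in> {1..k}. i j r = b})"
      by (auto simp: K_def)
    then have "k = card (K \<union> ({r \<in> {1..k}. i j r = a} \<union> {r \<in> {1..k}. i j r = b}))"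
      by (metis card_atLeastAtMost diff_Suc_1)
    also have "\<dots> \<le> card K + (card {r \<in> {1..k}. i j r = a} + card {r \<in> {1..k}. i j r = b})"
      by (intro order_trans[OF card_Un_le] add_left_mono card_Un_le)
    also have "\<dots> \<le> card K + (of_bool (a \<in> C j) + of_bool (b \<in> C j))"
      by (intro add_left_mono add_mono one)
    finally have le: "k \<le> card K + of_bool (a \<in> C j) + of_bool (b \<in> C j)" by simp
    have sub: "K \<subseteq> {1..k}" by (auto simp: K_def)
    have "embeds n ((P(j := P j \<circ> transpose a b)) l) K s (i l)" if l: "l \<in> {1..m}" for l
    proof (cases "l = j")
      case True
      have fixed: "transpose a b (i j r) = i j r" if "r \<in> K" for r
        using that by (auto simp: K_def Transposition.transpose_def)
      show ?thesis
        using embeds_subset[OF emb[OF j] sub] True by (simp add: embeds_def fixed)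
    qed (use embeds_subset[OF emb[OF l] sub] in simp)
    then have "\<exists>s. common_pattern n m (P(j := P j \<circ> transpose a b)) (card K) s"
      by (rule common_pattern_embeds[OF finite_subset[OF sub finite_atLeastAtMost]
            inj_on_subset[OF s sub] assms])
    then have "card K \<le> lcp_length n m (P(j := P j \<circ> transpose a b))"
      using lcp_length_ge[OF assms] by blast
    with le show ?thesis by linarith
  qed
  moreover have "C j \<subseteq> {1..n} \<and> card (C j) = k" if "j \<in> {1..m}" for j
    using emb[OF that] inj[OF that] by (auto simp: C_def embeds_def card_image)
  ultimately show thesis using that unfolding k_def by blast
qed

section \<open>The variance of the longest common pattern\<close>

lemma card_perms: "card (perms n) = fact n"
  by (simp add: perms_def card_permutations)

lemma finite_perms: "finite (perms n)"
  by (simp add: perms_def finite_permutations)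

definition tuples :: "nat \<Rightarrow> nat \<Rightarrow> (nat \<Rightarrow> nat \<Rightarrow> nat) set" where
  "tuples n m = PiE_dflt {1..m} id (\<lambda>_. perms n)"

lemma finite_tuples: "finite (tuples n m)"
  unfolding tuples_def by (intro finite_PiE_dflt finite_perms) simp

lemma card_tuples: "card (tuples n m) = fact n ^ m"
  unfolding tuples_def by (subst card_PiE_dflt) (simp_all add: finite_perms card_perms)

text \<open>
  Swapping two entries is an involution on the tuples, so it suffices to count the decreases of \<open>L\<close>
  and double. A decrease is at most the number of certificate positions among \<open>a, b\<close>; this number is
  at most 2, so squaring costs only another factor 2, and summing it over the \<open>n\<^sup>2\<close> pairs gives \<open>2 n L\<close>.
\<close>
lemma lcp_energy:
  assumes "m \<ge> 1" and j: "j \<in> {1..m}"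
  shows "(\<Sum>(a, b)\<in>{1..n} \<times> {1..n}. \<Sum>P\<in>tuples n m.
      (real (lcp_length n m P) - real (lcp_length n m (P(j := P j \<circ> transpose a b))))\<^sup>2)
    \<le> 8 * real n * (\<Sum>P\<in>tuples n m. real (lcp_length n m P))"
proof -
  define L where "L P = real (lcp_length n m P)" for P
  define sw where "sw a b P = P(j := P j \<circ> transpose a b)" for a b and P :: "nat \<Rightarrow> nat \<Rightarrow> nat"
  have "\<exists>C. C \<subseteq> {1..n} \<and> card C = lcp_length n m P \<and>
      (\<forall>a b. lcp_length n m P \<le> lcp_length n m (sw a b P) + of_bool (a \<in> C) + of_bool (b \<in> C))" for P
    using lcp_certificate[OF assms(1), of n P] j unfolding sw_def by metis
  then obtain C where C: "\<And>P. C P \<subseteq> {1..n}" "\<And>P. card (C P) = lcp_length n m P"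
    and le: "\<And>P a b. lcp_length n m P \<le> lcp_length n m (sw a b P) + of_bool (a \<in> C P) + of_bool (b \<in> C P)"
    by metis
  have half: "(\<Sum>P\<in>tuples n m. (L P - L (sw a b P))\<^sup>2)
      \<le> (\<Sum>P\<in>tuples n m. 4 * (of_bool (a \<in> C P) + of_bool (b \<in> C P)))"
    if ab: "a \<in> {1..n}" "b \<in> {1..n}" for a b
  proof -
    have bij: "bij_betw (sw a b) (tuples n m) (tuples n m)"
    proof (rule bij_betwI[where g = "sw a b"])
      show "sw a b \<in> tuples n m \<rightarrow> tuples n m" "sw a b \<in> tuples n m \<rightarrow> tuples n m"
        using j ab by (auto simp: sw_def tuples_def PiE_dflt_def perms_def intro!: permutes_compose permutes_swap_id)
    qed (auto simp: sw_def fun_eq_iff)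
    have inv: "sw a b (sw a b P) = P" for P by (auto simp: sw_def fun_eq_iff)
    have sq: "(L P - L (sw a b P))\<^sup>2 = (max 0 (L P - L (sw a b P)))\<^sup>2 + (max 0 (L (sw a b P) - L P))\<^sup>2" for P
      by (auto simp: max_def power2_commute)
    have "(\<Sum>P\<in>tuples n m. (max 0 (L (sw a b P) - L P))\<^sup>2)
        = (\<Sum>P\<in>tuples n m. (max 0 (L P - L (sw a b P)))\<^sup>2)"
      by (subst sum.reindex_bij_betw[OF bij, symmetric]) (simp add: inv)
    then have "(\<Sum>P\<in>tuples n m. (L P - L (sw a b P))\<^sup>2)
        = (\<Sum>P\<in>tuples n m. 2 * (max 0 (L P - L (sw a b P)))\<^sup>2)"
      by (simp add: sq sum.distrib flip: sum_distrib_left)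
    also have "\<dots> \<le> (\<Sum>P\<in>tuples n m. 4 * (of_bool (a \<in> C P) + of_bool (b \<in> C P)))"
    proof (rule sum_mono)
      fix P
      define u v :: real where "u = of_bool (a \<in> C P)" and "v = of_bool (b \<in> C P)"
      have "L P \<le> L (sw a b P) + u + v"
        using le[of P a b] unfolding L_def u_def v_def
        by (metis of_nat_add of_nat_le_iff of_nat_of_bool)
      then have "max 0 (L P - L (sw a b P)) \<le> u + v" by (simp add: u_def v_def)
      then have "(max 0 (L P - L (sw a b P)))\<^sup>2 \<le> (u + v)\<^sup>2" by (intro power_mono) auto
      also have "\<dots> \<le> 2 * (u + v)" by (auto simp: u_def v_def power2_eq_square)
      finally show "2 * (max 0 (L P - L (sw a b P)))\<^sup>2 \<le> 4 * (of_bool (a \<in> C P) + of_bool (b \<in> C P))"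
        by (simp add: u_def v_def)
    qed
    finally show ?thesis .
  qed
  have cnt: "(\<Sum>a=1..n. of_bool (a \<in> C P)) = L P" for P
  proof -
    have "(\<Sum>a=1..n. of_bool (a \<in> C P)) = real (card ({1..n} \<inter> C P))"
      by (simp add: sum_of_bool_eq Int_def)
    then show ?thesis using C[of P] by (simp add: L_def Int_absorb1)
  qed
  have "(\<Sum>(a, b)\<in>{1..n} \<times> {1..n}. \<Sum>P\<in>tuples n m. (L P - L (sw a b P))\<^sup>2)
      \<le> (\<Sum>(a, b)\<in>{1..n} \<times> {1..n}. \<Sum>P\<in>tuples n m. 4 * (of_bool (a \<in> C P) + of_bool (b \<in> C P)))"
    by (rule sum_mono) (use half in auto)
  also have "\<dots> = (\<Sum>P\<in>tuples n m. \<Sum>a=1..n. \<Sum>b=1..n. 4 * (of_bool (a \<in> C P) + of_bool (b \<in> C P)))"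
    by (simp only: case_prod_unfold sum.swap[of _ "tuples n m" "{1..n} \<times> {1..n}"])
       (intro sum.cong refl, simp only: sum.cartesian_product case_prod_unfold)
  also have "\<dots> = (\<Sum>P\<in>tuples n m. 8 * real n * L P)"
    by (intro sum.cong refl)
       (simp only: sum_distrib_left[symmetric] sum.distrib cnt sum_constant, simp)
  finally show ?thesis by (simp add: L_def sw_def sum_distrib_left)
qed

lemma ssd_lcp_length:
  assumes "m \<ge> 1" "n \<ge> 1"
  shows "ssd (tuples n m) (\<lambda>P. real (lcp_length n m P))
    \<le> 4 * real m * (\<Sum>P\<in>tuples n m. real (lcp_length n m P))"
proof -
  let ?L = "\<lambda>P. real (lcp_length n m P)"
  let ?E = "\<lambda>j. \<Sum>(a, b)\<in>{1..n} \<times> {1..n}. \<Sum>P\<in>tuples n m. (?L P - ?L (P(j := P j \<circ> transpose a b)))\<^sup>2"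
  have "ssd (tuples n m) ?L \<le> 1 / (2 * real n) * (\<Sum>j\<in>{1..m}. \<Sum>x\<in>{1..n} \<times> {1..n}. \<Sum>P\<in>tuples n m.
      (?L P - ?L (P(j := P j \<circ> transpose (fst x) (snd x))))\<^sup>2)"
    unfolding tuples_def
  proof (rule ssd_PiE_dflt_le[OF finite_perms finite_atLeastAtMost])
    fix g :: "(nat \<Rightarrow> nat) \<Rightarrow> real"
    show "ssd (perms n) g \<le> 1 / (2 * real n) *
        (\<Sum>x\<in>{1..n} \<times> {1..n}. \<Sum>p\<in>perms n. (g p - g (p \<circ> transpose (fst x) (snd x)))\<^sup>2)"
      using ssd_permutes_le[of "{1..n}" g] unfolding perms_def case_prod_unfold card_atLeastAtMost by simp
  qed
  also have "\<dots> = 1 / (2 * real n) * (\<Sum>j\<in>{1..m}. ?E j)"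
    by (simp add: case_prod_unfold)
  also have "\<dots> \<le> 1 / (2 * real n) * (\<Sum>j\<in>{1..m}. 8 * real n * (\<Sum>P\<in>tuples n m. ?L P))"
    by (intro mult_left_mono sum_mono lcp_energy assms(1)) auto
  also have "\<dots> = 4 * real m * (\<Sum>P\<in>tuples n m. ?L P)"
    using assms(2) by simp
  finally show ?thesis .
qed

section \<open>The mean of the longest common pattern\<close>

text \<open>
  Take a permutation with the pattern at the positions \<open>I\<close> and rearrange its entries there in all
  \<open>k!\<close> ways. No result arises twice: it determines the set of values on \<open>I\<close>, hence, by the
  prescribed relative order, the permutation from which it arose.
\<close>
lemma card_contains_pattern_at:
  assumes "finite I" "I \<subseteq> {1..n}" "card I = k"
  shows "card {p \<in> perms n. \<exists>i. i ` {1..k} = I \<and> embeds n p {1..k} s i} * fact k \<le> fact n"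
proof -
  define A where "A = {p \<in> perms n. \<exists>i. i ` {1..k} = I \<and> embeds n p {1..k} s i}"
  have "inj_on (\<lambda>(t, p). p \<circ> t) ({t. t permutes I} \<times> A)"
  proof (rule inj_onI, safe)
    fix t p t' p'
    assume t: "t permutes I" "t' permutes I" and p: "p \<in> A" "p' \<in> A" and eq: "p \<circ> t = p' \<circ> t'"
    have pp: "p permutes {1..n}" "p' permutes {1..n}" using p by (auto simp: A_def perms_def)
    obtain i i' where i: "i ` {1..k} = I" "embeds n p {1..k} s i"
      and i': "i' ` {1..k} = I" "embeds n p' {1..k} s i'"
      using p by (auto simp: A_def)
    have mono: "strict_mono_on {1..k} i" "strict_mono_on {1..k} i'"
      using i i' by (auto simp: embeds_def)
    have ii: "i a = i' a" if "a \<in> {1..k}" for a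
    proof (rule order_iso_eq[OF _ _ _ _ _ that])
      show "i ` {1..k} = i' ` {1..k}" using i(1) i'(1) by simp
      show "i b < i c \<longleftrightarrow> i' b < i' c" if "b \<in> {1..k}" "c \<in> {1..k}" for b c
        using strict_mono_on_less[OF mono(1) that] strict_mono_on_less[OF mono(2) that] by simp
    qed (use mono in \<open>auto intro: strict_mono_on_imp_inj_on simp del: One_nat_def\<close>)
    have im: "p ` I = p' ` I"
      using permutes_image[OF t(1)] permutes_image[OF t(2)] eq by (metis image_comp)
    have ord: "p x < p y \<longleftrightarrow> p' x < p' y" if xy: "x \<in> I" "y \<in> I" for x y
    proof -
      obtain a b where ab: "a \<in> {1..k}" "b \<in> {1..k}" "x = i a" "y = i b"
        using xy i(1) by blast
      have "p (i a) < p (i b) \<longleftrightarrow> s a < s b" "p' (i' a) < p' (i' b) \<longleftrightarrow> s a < s b"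
        using i(2) i'(2) ab(1,2) unfolding embeds_def by blast+
      then show ?thesis using ab ii by simp
    qed
    have "p x = p' x" for x
    proof (cases "x \<in> I")
      case True
      then show ?thesis
        using assms(1) im ord
        by (intro order_iso_eq[of I]) (auto intro: permutes_inj_on[OF pp(1)] permutes_inj_on[OF pp(2)])
    next
      case False
      then show ?thesis
        using fun_cong[OF eq, of x] permutes_not_in[OF t(1)] permutes_not_in[OF t(2)] by simp
    qed
    then show pe: "p = p'" by auto
    show "t = t'"
    proof
      fix x show "t x = t' x"
        using fun_cong[OF eq, of x] pe injD[OF permutes_inj[OF pp(1)]] by simp
    qed
  qed
  moreover have "(\<lambda>(t, p). p \<circ> t) ` ({t. t permutes I} \<times> A) \<subseteq> perms n"
    using assms(2) by (auto simp: A_def perms_def intro!: permutes_compose dest: permutes_subset)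
  ultimately have "card ({t. t permutes I} \<times> A) \<le> card (perms n)"
    by (intro card_inj_on_le[OF _ _ finite_perms])
  then show ?thesis
    using assms(1,3) by (simp add: card_cartesian_product card_permutations card_perms A_def mult.commute)
qed

lemma card_contains_pattern:
  "card {p \<in> perms n. contains_pattern n p k s} * fact k \<le> (n choose k) * fact n"
proof -
  define A where "A I = {p \<in> perms n. \<exists>i. i ` {1..k} = I \<and> embeds n p {1..k} s i}" for I
  define U where "U = {I. I \<subseteq> {1..n} \<and> card I = k}"
  have fU: "finite U" by (simp add: U_def)
  have "{p \<in> perms n. contains_pattern n p k s} \<subseteq> (\<Union>I\<in>U. A I)"
  proof safe
    fix p assume p: "p \<in> perms n" "contains_pattern n p k s"
    then obtain i where i: "embeds n p {1..k} s i" by (auto simp: contains_pattern_embeds)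
    then have "inj_on i {1..k}" "i ` {1..k} \<subseteq> {1..n}"
      by (auto simp: embeds_def intro: strict_mono_on_imp_inj_on)
    then have "i ` {1..k} \<in> U" by (simp add: U_def card_image)
    then show "p \<in> (\<Union>I\<in>U. A I)" using p i by (auto simp: A_def)
  qed
  then have "card {p \<in> perms n. contains_pattern n p k s} \<le> card (\<Union>I\<in>U. A I)"
    using fU by (intro card_mono) (auto simp: A_def finite_perms)
  also have "\<dots> \<le> (\<Sum>I\<in>U. card (A I))" by (rule card_UN_le[OF fU])
  finally have "card {p \<in> perms n. contains_pattern n p k s} * fact k \<le> (\<Sum>I\<in>U. card (A I)) * fact k"
    by (rule mult_right_mono) simp
  also have "\<dots> = (\<Sum>I\<in>U. card (A I) * fact k)" by (rule sum_distrib_right)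
  also have "\<dots> \<le> (\<Sum>I\<in>U. fact n)"
  proof (rule sum_mono)
    fix I assume "I \<in> U"
    then have I: "I \<subseteq> {1..n}" "card I = k" by (auto simp: U_def)
    show "card (A I) * fact k \<le> fact n"
      unfolding A_def by (rule card_contains_pattern_at[OF _ I]) (use I finite_subset in blast)
  qed
  also have "\<dots> = (n choose k) * fact n"
    by (simp add: U_def n_subsets)
  finally show ?thesis .
qed

lemma fact_ge_power: "(real k / 3) ^ k \<le> fact k"
proof -
  have "(\<Sum>i\<in>{k}. inverse (fact i) * real k ^ i) \<le> (\<Sum>i. inverse (fact i) * real k ^ i)"
    by (rule sum_le_suminf[OF summable_exp]) auto
  also have "\<dots> = exp (real k)" by (simp add: exp_def scaleR_conv_of_real)
  also have "\<dots> = exp 1 ^ k" by (simp flip: exp_of_nat_mult)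
  also have "\<dots> \<le> 3 ^ k" by (intro power_mono exp_le) auto
  finally show ?thesis by (simp add: field_simps)
qed

text \<open>
  Union bound over the patterns of length \<open>k\<close>; having \<open>L \<ge> k\<close> produces a common pattern of length
  exactly \<open>k\<close> because subpatterns of common patterns are common.
\<close>
lemma card_lcp_length_ge:
  "real (card {P \<in> tuples n m. k \<le> lcp_length n m P}) * fact k ^ (2 * m) \<le> fact k * (real n ^ k) ^ m * fact n ^ m"
  if m: "m \<ge> 1"
proof -
  define c where "c s = card {p \<in> perms n. contains_pattern n p k s}" for s
  define B where "B s = PiE_dflt {1..m} id (\<lambda>_. {p \<in> perms n. contains_pattern n p k s})" for s
  have finB: "finite (B s)" for s
    unfolding B_def by (intro finite_PiE_dflt) (auto simp: finite_perms)
  have cardB: "card (B s) = c s ^ m" for s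
    unfolding B_def by (subst card_PiE_dflt) (simp_all add: finite_perms c_def)
  have "{P \<in> tuples n m. k \<le> lcp_length n m P} \<subseteq> (\<Union>s\<in>perms k. B s)"
  proof safe
    fix P assume P: "P \<in> tuples n m" "k \<le> lcp_length n m P"
    obtain s where "common_pattern n m P k s" using common_pattern_if_le_lcp[OF m P(2)] by blast
    then have "s \<in> perms k" "P \<in> B s"
      using P(1) by (auto simp: common_pattern_def B_def tuples_def PiE_dflt_def)
    then show "P \<in> (\<Union>s\<in>perms k. B s)" by blast
  qed
  then have "card {P \<in> tuples n m. k \<le> lcp_length n m P} \<le> card (\<Union>s\<in>perms k. B s)"
    by (intro card_mono finite_UN_I finite_perms finB)
  also have "\<dots> \<le> (\<Sum>s\<in>perms k. card (B s))" by (rule card_UN_le[OF finite_perms])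
  finally have "card {P \<in> tuples n m. k \<le> lcp_length n m P} \<le> (\<Sum>s\<in>perms k. c s ^ m)"
    by (simp add: cardB)
  then have "card {P \<in> tuples n m. k \<le> lcp_length n m P} * fact k ^ (2 * m)
      \<le> (\<Sum>s\<in>perms k. c s ^ m) * fact k ^ (2 * m)"
    by (rule mult_right_mono) simp
  also have "\<dots> = (\<Sum>s\<in>perms k. (c s * fact k * fact k) ^ m)"
    by (simp add: sum_distrib_right power_mult_distrib power_mult power2_eq_square mult.assoc)
  also have "\<dots> \<le> (\<Sum>s\<in>perms k. (n ^ k * fact n) ^ m)"
  proof (intro sum_mono power_mono)
    fix s
    have "c s * fact k * fact k \<le> (n choose k) * fact n * fact k"
      unfolding c_def by (intro mult_right_mono card_contains_pattern) simp
    also have "\<dots> = (n choose k) * fact k * fact n" by simp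
    also have "\<dots> \<le> n ^ k * fact n" by (intro mult_right_mono binomial_fact_pow) simp
    finally show "c s * fact k * fact k \<le> n ^ k * fact n" .
  qed simp
  also have "\<dots> = fact k * (n ^ k) ^ m * fact n ^ m"
    by (simp add: card_perms power_mult_distrib)
  finally have "real (card {P \<in> tuples n m. k \<le> lcp_length n m P} * fact k ^ (2 * m))
      \<le> real (fact k * (n ^ k) ^ m * fact n ^ m)" by (rule of_nat_mono)
  then show ?thesis by simp
qed

text \<open>
  With \<open>q = 2 m - 1\<close> the union bound is at most \<open>(n ^ m / (k / 3) ^ q) ^ k\<close>. The constant \<open>6\<close> is
  twice the \<open>3\<close> from \<open>(k / 3) ^ k \<le> k!\<close>, so that at least a factor \<open>2 ^ k\<close> is gained. Only \<open>k \<le> 2 ^ k\<close> is kept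
  of it, as the tail is multiplied merely by \<open>n\<close> below.
\<close>
lemma lcp_length_tail:
  assumes m: "m \<ge> 1" and n: "n \<ge> 1" and k: "real k \<ge> 6 * real n powr (real m / (2 * real m - 1))"
  shows "real (card {P \<in> tuples n m. k \<le> lcp_length n m P}) \<le> fact n ^ m / real k"
proof -
  define q where "q = 2 * m - 1"
  have q: "q \<ge> 1" "real q = 2 * real m - 1" "2 * m = Suc q" using m by (auto simp: q_def)
  have kpos: "real k > 0" using k n by (smt (verit) powr_gt_zero of_nat_0_less_iff less_le_trans zero_less_one)
  have "(real n powr (real m / (2 * real m - 1))) ^ q = real n powr real m"
  proof -
    have "2 * real m - 1 \<noteq> 0" using m by simp
    then have "real m / (2 * real m - 1) * real q = real m" unfolding q(2) by simp
    then show ?thesis using n by (simp add: powr_powr flip: powr_realpow)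
  qed
  also have "\<dots> = real n ^ m" using n by (simp add: powr_realpow)
  finally have nm: "(6 * real n powr (real m / (2 * real m - 1))) ^ q = 6 ^ q * real n ^ m"
    by (simp only: power_mult_distrib)
  have "real n ^ m = (6 * real n powr (real m / (2 * real m - 1))) ^ q / 6 ^ q"
    unfolding nm by simp
  also have "\<dots> \<le> real k ^ q / 6 ^ q"
    using k by (intro divide_right_mono power_mono) auto
  finally have le1: "real n ^ m \<le> (real k / 6) ^ q" by (simp add: power_divide)
  have "(real n ^ k) ^ m = (real n ^ m) ^ k" by (simp add: mult.commute flip: power_mult)
  also have "\<dots> \<le> ((real k / 6) ^ q) ^ k" by (rule power_mono[OF le1]) simp
  also have "\<dots> = ((1 / 2) ^ k) ^ q * ((real k / 3) ^ k) ^ q"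
    by (simp add: mult.commute flip: power_mult power_mult_distrib)
  also have "\<dots> \<le> (1 / 2) ^ k * fact k ^ q"
  proof (rule mult_mono)
    show "((1 / 2 :: real) ^ k) ^ q \<le> (1 / 2) ^ k"
      using power_decreasing[OF q(1), of "(1 / 2 :: real) ^ k"] by (simp add: power_le_one)
    show "((real k / 3) ^ k) ^ q \<le> fact k ^ q"
      by (intro power_mono fact_ge_power) simp
  qed auto
  also have "\<dots> \<le> 1 / real k * fact k ^ q"
  proof (rule mult_right_mono)
    have "real k \<le> 2 ^ k" using of_nat_less_two_power[of k, where 'a = real] by simp
    then show "(1 / 2) ^ k \<le> 1 / real k" using kpos by (simp add: field_simps power_divide)
  qed simp
  finally have le2: "(real n ^ k) ^ m \<le> fact k ^ q / real k" by simp
  have "real (card {P \<in> tuples n m. k \<le> lcp_length n m P}) * fact k ^ Suc q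
      \<le> fact k * (real n ^ k) ^ m * fact n ^ m"
    using card_lcp_length_ge[OF m, of n k] by (simp only: q(3))
  also have "\<dots> \<le> fact k * (fact k ^ q / real k) * fact n ^ m"
    by (intro mult_right_mono mult_left_mono le2) auto
  also have "\<dots> = (fact n ^ m / real k) * fact k ^ Suc q" by simp
  finally show ?thesis by (rule mult_right_le_imp_le) simp
qed

text \<open>
  The mean is at most \<open>k\<close> plus \<open>n\<close> times the probability of \<open>L \<ge> k\<close>. With \<open>k\<close> of order
  \<open>n powr \<alpha>\<close> the second term is at most \<open>n powr (1 - \<alpha>)\<close>, and \<open>\<alpha> \<ge> 1/2\<close>.
\<close>
lemma sum_lcp_length_le:
  assumes m: "m \<ge> 1" and n: "n \<ge> 1"
  shows "(\<Sum>P\<in>tuples n m. real (lcp_length n m P)) \<le> 8 * real n powr (real m / (2 * real m - 1)) * fact n ^ m"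
proof -
  define \<alpha> where "\<alpha> = real m / (2 * real m - 1)"
  define k where "k = nat \<lceil>6 * real n powr \<alpha>\<rceil>"
  define x where "x = real n powr \<alpha>"
  define T where "T = {P \<in> tuples n m. k \<le> lcp_length n m P}"
  have \<alpha>: "1 - \<alpha> \<le> \<alpha>" "\<alpha> > 0" using m by (auto simp: \<alpha>_def field_simps)
  have x: "x \<ge> 1" using n \<alpha> by (simp add: x_def ge_one_powr_ge_zero)
  have k: "real k \<ge> 6 * x" "real k \<le> 6 * x + 1"
    using x by (auto simp: k_def x_def[symmetric])
  have T: "real (card T) \<le> fact n ^ m / real k"
    unfolding T_def using lcp_length_tail[OF m n, of k] k by (simp add: x_def \<alpha>_def)
  have "real n = real n powr (1 - \<alpha>) * x" using n by (simp add: x_def flip: powr_add)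
  also have "\<dots> \<le> x * x"
    using n \<alpha> x unfolding x_def by (intro mult_right_mono powr_mono) auto
  also have "\<dots> \<le> x * real k" using k x by (intro mult_left_mono) auto
  finally have nk: "real n / real k \<le> x" using k x by (simp add: field_simps)
  have "(\<Sum>P\<in>tuples n m. real (lcp_length n m P))
      \<le> (\<Sum>P\<in>tuples n m. real k + real n * of_bool (P \<in> T))"
  proof (rule sum_mono)
    fix P assume "P \<in> tuples n m"
    then show "real (lcp_length n m P) \<le> real k + real n * of_bool (P \<in> T)"
      using lcp_length_le[OF m, of n P] by (auto simp: T_def)
  qed
  also have "\<dots> = real k * fact n ^ m + real n * real (card T)"
  proof -
    have "T \<subseteq> tuples n m" by (auto simp: T_def)
    then have "(\<Sum>P\<in>tuples n m. of_bool (P \<in> T)) = (\<Sum>P\<in>T. 1 :: real)"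
      by (intro sum.mono_neutral_cong_right finite_tuples) auto
    then have "(\<Sum>P\<in>tuples n m. of_bool (P \<in> T)) = real (card T)" by simp
    then show ?thesis
      by (simp add: sum.distrib card_tuples flip: sum_distrib_left)
  qed
  also have "\<dots> \<le> real k * fact n ^ m + real n * (fact n ^ m / real k)"
    by (intro add_left_mono mult_left_mono T) simp
  also have "\<dots> = (real k + real n / real k) * fact n ^ m" by (simp add: algebra_simps)
  also have "\<dots> \<le> (8 * x) * fact n ^ m"
    using k nk x by (intro mult_right_mono) auto
  finally show ?thesis by (simp add: x_def \<alpha>_def)
qed

section \<open>Concentration\<close>

lemma prob_lcp_deviation:
  assumes m: "m \<ge> 1" and n: "n \<ge> 1" and u: "u > 0"
  shows "measure_pmf.prob (random_perms n m)
      {P. \<bar>real (lcp_length n m P)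
            - measure_pmf.expectation (random_perms n m) (\<lambda>Q. real (lcp_length n m Q))\<bar>
          \<ge> u * real n powr (real m / (4 * real m - 2))} \<le> 32 * real m / u\<^sup>2"
proof -
  let ?L = "\<lambda>P. real (lcp_length n m P)"
  define M where "M = random_perms n m"
  define N where "N = real (card (tuples n m))"
  define \<mu> where "\<mu> = measure_pmf.expectation M ?L"
  define a where "a = u * real n powr (real m / (4 * real m - 2))"
  have a: "a > 0" using u n by (simp add: a_def)
  have a2: "a\<^sup>2 = u\<^sup>2 * real n powr (real m / (2 * real m - 1))"
  proof -
    define c where "c = 2 * real m - 1"
    have c: "c > 0" "4 * real m - 2 = 2 * c" using m by (simp_all add: c_def)
    have "real m / (4 * real m - 2) + real m / (4 * real m - 2) = real m / c"
      unfolding c(2) using c(1) by (simp add: field_simps)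
    then have "real m / (4 * real m - 2) + real m / (4 * real m - 2) = real m / (2 * real m - 1)"
      by (simp only: c_def)
    then show ?thesis by (simp add: a_def power2_eq_square flip: powr_add)
  qed
  have N: "N > 0" by (simp add: N_def card_tuples)
  have ne: "tuples n m \<noteq> {}" using N unfolding N_def by (metis card.empty of_nat_0 order.irrefl)
  have pne: "perms n \<noteq> {}" by (metis card_perms card.empty fact_nonzero)
  have M: "M = pmf_of_set (tuples n m)"
    unfolding M_def random_perms_def tuples_def using finite_perms pne by (intro Pi_pmf_of_set) auto
  have E: "measure_pmf.expectation M f = (\<Sum>P\<in>tuples n m. f P) / N" for f :: "_ \<Rightarrow> real"
    unfolding M N_def by (rule integral_pmf_of_set[OF ne finite_tuples])
  have int: "integrable (measure_pmf M) f" for f :: "_ \<Rightarrow> real"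
    unfolding M by (rule integrable_measure_pmf_finite) (simp add: ne finite_tuples)
  have "measure_pmf.variance M ?L = ssd (tuples n m) ?L / N"
    by (subst measure_pmf.variance_eq[OF int int])
       (use N in \<open>simp add: E ssd_def N_def[symmetric] diff_divide_distrib power2_eq_square\<close>)
  also have "\<dots> \<le> 4 * real m * (\<Sum>P\<in>tuples n m. ?L P) / N"
    using N by (intro divide_right_mono ssd_lcp_length m n) simp
  also have "\<dots> \<le> 4 * real m * (8 * real n powr (real m / (2 * real m - 1)) * N) / N"
    using sum_lcp_length_le[OF m n] N
    by (intro divide_right_mono mult_left_mono) (simp_all add: N_def card_tuples)
  also have "\<dots> = 32 * real m * real n powr (real m / (2 * real m - 1))"
    using N by simp
  finally have var: "measure_pmf.variance M ?L \<le> 32 * real m * real n powr (real m / (2 * real m - 1))" .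
  have "measure_pmf.prob M {P \<in> space (measure_pmf M). \<bar>?L P - \<mu>\<bar> \<ge> a} \<le> measure_pmf.variance M ?L / a\<^sup>2"
    unfolding \<mu>_def by (rule measure_pmf.Chebyshev_inequality[OF _ int a]) simp
  also have "\<dots> \<le> 32 * real m * real n powr (real m / (2 * real m - 1)) / a\<^sup>2"
    by (rule divide_right_mono[OF var]) simp
  also have "\<dots> = 32 * real m / u\<^sup>2"
    using n by (simp add: a2)
  finally show ?thesis by (simp add: M_def \<mu>_def a_def)
qed

theorem mainTheorem3:
  fixes m :: nat and t :: "nat \<Rightarrow> real"
  assumes "m \<ge> 2"
    and "\<And>n. n \<ge> 1 \<Longrightarrow> t n > 0"
    and "filterlim t at_top sequentially"
  shows "(\<lambda>n. measure_pmf.prob (random_perms n m)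
            {P. \<bar>real (lcp_length n m P)
                  - measure_pmf.expectation (random_perms n m) (\<lambda>Q. real (lcp_length n m Q))\<bar>
                \<ge> t n * real n powr (real m / (4 * real m - 2))})
         \<longlonglongrightarrow> 0"
proof (rule tendsto_sandwich[where f = "\<lambda>_. 0" and h = "\<lambda>n. 32 * real m / (t n)\<^sup>2"])
  show "\<forall>\<^sub>F n in sequentially. measure_pmf.prob (random_perms n m)
            {P. \<bar>real (lcp_length n m P)
                  - measure_pmf.expectation (random_perms n m) (\<lambda>Q. real (lcp_length n m Q))\<bar>
                \<ge> t n * real n powr (real m / (4 * real m - 2))} \<le> 32 * real m / (t n)\<^sup>2"
    using eventually_ge_at_top[of 1]
  proof eventually_elim
    case (elim n)
    show ?case using assms(1) by (intro prob_lcp_deviation elim assms(2)) simp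
  qed
  show "(\<lambda>n. 32 * real m / (t n)\<^sup>2) \<longlonglongrightarrow> 0"
    by (intro tendsto_divide_0[OF tendsto_const] filterlim_at_top_imp_at_infinity
        filterlim_pow_at_top assms(3)) simp
qed simp_all

end
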